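(* Let $q$ be a prime power with $q\equiv 1\pmod 4$, let $\mathbb{F}_q$ be the finite field with $q$ elements, and let $\mathbb{F}_q^+:=\{x^2 : x\in\mathbb{F}_q,\ x\neq 0\}$. If $f:\mathbb{F}_q\to\mathbb{F}_q$ is a function that preserves positive definiteness on $M_2(\mathbb{F}_q)$ (that is, $f[A]$ is positive definite whenever $A\in M_2(\mathbb{F}_q)$ is positive definite), then the restriction of $f$ to $\mathbb{F}_q^+$ is injective.
   Context: $\mathbb{F}_q$ denotes the finite field with $q$ elements and $\mathbb{F}_q^\times=\mathbb{F}_q\setminus\{0\}$. $\mathbb{F}_q^+:=\{x^2:x\in\mathbb{F}_q^\times\}$ is the set of nonzero squares. $M_n(\mathbb{F}_q)$ is the set of $n\times n$ matrices over $\mathbb{F}_q$. A matrix $A\in M_n(\mathbb{F}_q)$ is called positive definite if it is symmetric and all its leading principal minors (the determinants of its upper-left $r\times r$ submatrices, $1\le r\le n$) belong to $\mathbb{F}_q^+$. For a function $f:\mathbb{F}_q\to\mathbb{F}_q$ and $A=(a_{ij})\in M_n(\mathbb{F}_q)$, $f[A]:=(f(a_{ij}))$ denotes the matrix obtained by applying $f$ entrywise. The function $f$ preserves positive definiteness on $M_n(\mathbb{F}_q)$ (is an entrywise positivity preserver) if $f[A]$ is positive definite whenever $A\in M_n(\mathbb{F}_q)$ is positive definite. *)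

theory Defs
  imports "Jordan_Normal_Form.Determinant" "HOL-Library.Cardinality"
begin

definition nonzero_squares :: "'a::field set" where
  "nonzero_squares = {x^2 | x. x \<noteq> 0}"

(* Meaningful only if r is at most both dimensions of A: otherwise A is indexed out of bounds. *)
definition leading_principal_minor :: "'a::comm_ring_1 mat \<Rightarrow> nat \<Rightarrow> 'a" where
  "leading_principal_minor A r = det (mat r r (\<lambda>ij. A $$ ij))"

definition positive_definite :: "nat \<Rightarrow> 'a::field mat \<Rightarrow> bool" where
  "positive_definite n A \<longleftrightarrow>
     A \<in> carrier_mat n n \<and> transpose_mat A = A \<and>
     (\<forall>r\<in>{1..n}. leading_principal_minor A r \<in> nonzero_squares)"

definition preserves_positive_definiteness :: "nat \<Rightarrow> ('a::field \<Rightarrow> 'a) \<Rightarrow> bool" where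
  "preserves_positive_definiteness n f \<longleftrightarrow>
     (\<forall>A\<in>carrier_mat n n. positive_definite n A \<longrightarrow> positive_definite n (map_mat f A))"

end

theory Submission
  imports Defs
begin

text \<open>
  Write \<open>S\<close> for the nonzero squares; \<open>- 1 \<in> S\<close> because \<open>q mod 4 = 1\<close>, and \<open>f\<close> maps \<open>S\<close> to \<open>S\<close>.
  Testing \<open>f\<close> on the matrices \<open>(a, a; a, c)\<close> and \<open>(a, c; c, c)\<close> with \<open>a \<in> S\<close> and \<open>c\<close> a
  nonsquare shows three things.
  First, \<open>f a \<noteq> f c\<close>, and likewise for every iterate of \<open>f\<close>; if \<open>f c \<in> S\<close>, then the orbit of \<open>c\<close>
  stays in \<open>S\<close> from there on, and its eventual periodicity gives a contradiction.
  Second, if \<open>f c = 0\<close>, then \<open>a - c \<in> S\<close> for every \<open>a \<in> S\<close>, which a count excludes.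
  So \<open>f c\<close> is a nonsquare, and then \<open>a - c \<in> S\<close> if and only if \<open>f a - f c \<in> S\<close>.
  Hence, if \<open>f a = f b\<close> with \<open>a \<noteq> b\<close> in \<open>S\<close>, then \<open>(a - c) / (b - c) \<in> S - {1}\<close> for every
  nonsquare \<open>c\<close>. This is an injective function of \<open>c\<close>, but there are as many nonsquares
  as elements of \<open>S\<close>.
\<close>

section \<open>Counting by fibres of size two\<close>

lemma card_eq_twice_card_image:
  assumes "finite A" and "\<And>x. x \<in> A \<Longrightarrow> card {y \<in> A. g y = g x} = 2"
  shows "card A = 2 * card (g ` A)"
proof -
  have "card A = (\<Sum>z\<in>g ` A. card {y \<in> A. g y = z})"
    using sum.image_gen[OF assms(1), of "\<lambda>_. 1::nat" g] by simp
  also have "\<dots> = (\<Sum>z\<in>g ` A. 2)"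
    using assms(2) by (intro sum.cong) auto
  finally show ?thesis by simp
qed

lemma even_card_if_fixpoint_free_involution:
  assumes "finite A"
    and i: "\<And>x. x \<in> A \<Longrightarrow> i x \<in> A" "\<And>x. x \<in> A \<Longrightarrow> i (i x) = x" "\<And>x. x \<in> A \<Longrightarrow> i x \<noteq> x"
  shows "even (card A)"
proof -
  have "card {y \<in> A. {y, i y} = {x, i x}} = 2" if "x \<in> A" for x
  proof -
    have "{y \<in> A. {y, i y} = {x, i x}} = {x, i x}"
      using i that by (auto simp: doubleton_eq_iff)
    then show ?thesis using i(3)[OF that] by simp
  qed
  then have "card A = 2 * card ((\<lambda>x. {x, i x}) ` A)"
    using assms(1) by (intro card_eq_twice_card_image) auto
  then show ?thesis by simp
qed

section \<open>Squares and nonsquares of a finite field of odd order\<close>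

lemma zero_notin_nonzero_squares [simp]: "0 \<notin> nonzero_squares"
  by (auto simp: nonzero_squares_def)

lemma one_in_nonzero_squares [simp]: "1 \<in> nonzero_squares"
  unfolding nonzero_squares_def by (rule CollectI, rule exI[of _ 1]) simp

lemma nonzero_squares_mult:
  "x \<in> nonzero_squares \<Longrightarrow> y \<in> nonzero_squares \<Longrightarrow> x * y \<in> nonzero_squares"
  unfolding nonzero_squares_def by (auto simp flip: power_mult_distrib)

lemma nonzero_squares_inverse:
  "x \<in> nonzero_squares \<Longrightarrow> inverse x \<in> nonzero_squares"
  unfolding nonzero_squares_def by (auto simp flip: power_inverse)

lemma nonzero_squares_mult_iff:
  assumes "x \<in> nonzero_squares"
  shows "x * y \<in> nonzero_squares \<longleftrightarrow> y \<in> nonzero_squares"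
proof
  assume "x * y \<in> nonzero_squares"
  with assms have "inverse x * (x * y) \<in> nonzero_squares"
    by (simp add: nonzero_squares_mult nonzero_squares_inverse del: mult_cancel_left)
  moreover have "x \<noteq> 0" using assms by auto
  ultimately show "y \<in> nonzero_squares" by (simp flip: mult.assoc)
qed (use assms in \<open>rule nonzero_squares_mult\<close>)

definition nonsquares :: "'a::field set" where
  "nonsquares = - insert 0 nonzero_squares"

lemma card_nonzero_squares:
  assumes "odd (CARD('a::{field, finite}))"
  shows "2 * card (nonzero_squares :: 'a set) = CARD('a) - 1"
proof -
  \<comment> \<open>Otherwise translation by 1 is a fixpoint-free involution of the field, whose
    order is odd.\<close>
  have "(-1 :: 'a) \<noteq> 1"
  proof
    assume "(-1 :: 'a) = 1"
    then have "(1 :: 'a) + 1 = 0" by (metis add.right_inverse)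
    then have "even (card (UNIV :: 'a set))"
      by (intro even_card_if_fixpoint_free_involution[where i = "\<lambda>x. x + 1"])
        (auto simp: add.assoc)
    with assms show False by simp
  qed
  then have neg: "- x \<noteq> x" if "x \<noteq> 0" for x :: 'a
    using that by (metis mult_cancel_right mult_minus_left mult_1)
  have "card {y \<in> - {0}. y\<^sup>2 = x\<^sup>2} = 2" if "x \<in> - {0}" for x :: 'a
  proof -
    have "{y \<in> - {0}. y\<^sup>2 = x\<^sup>2} = {x, - x}"
      using that by (auto simp: power2_eq_iff)
    then show ?thesis using neg[of x] that by (auto simp: card_insert_if)
  qed
  then have "card (- {0 :: 'a}) = 2 * card ((\<lambda>x. x\<^sup>2) ` (- {0 :: 'a}))"
    by (intro card_eq_twice_card_image) auto
  moreover have "(\<lambda>x. x\<^sup>2) ` (- {0 :: 'a}) = nonzero_squares"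
    by (auto simp: nonzero_squares_def)
  ultimately show ?thesis by (simp add: Compl_eq_Diff_UNIV card_Diff_singleton)
qed

lemma card_nonsquares:
  assumes "odd (CARD('a::{field, finite}))"
  shows "card (nonsquares :: 'a set) = card (nonzero_squares :: 'a set)"
  using card_nonzero_squares[OF assms] by (simp add: nonsquares_def Compl_eq_Diff_UNIV card_Diff_subset)

text \<open>Multiplication by \<open>x\<close> sends S injectively into the nonsquares, which are
  equally many. If \<open>x * y\<close> were a nonsquare too, the larger set S with \<open>y\<close>
  added would still fit.\<close>

lemma nonsquares_mult:
  fixes x y :: "'a::{field, finite}"
  assumes "odd (CARD('a))" and x: "x \<in> nonsquares" and y: "y \<in> nonsquares"
  shows "x * y \<in> nonzero_squares"
proof (rule ccontr)
  assume xy: "x * y \<notin> nonzero_squares"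
  have x0: "x \<noteq> 0" and y0: "y \<noteq> 0" using x y by (auto simp: nonsquares_def)
  have "(*) x ` insert y nonzero_squares \<subseteq> nonsquares"
    using x x0 y0 xy nonzero_squares_mult_iff[of _ x]
    by (auto simp: nonsquares_def mult.commute)
  then have "card ((*) x ` insert y nonzero_squares) \<le> card (nonsquares :: 'a set)"
    by (intro card_mono) auto
  moreover have "card ((*) x ` insert y nonzero_squares) = Suc (card (nonzero_squares :: 'a set))"
    using x0 y by (subst card_image) (auto simp: inj_on_def nonsquares_def)
  ultimately show False using card_nonsquares[OF assms(1)] by simp
qed

text \<open>The order of S is even. If -1 were not in S, inversion would have no fixpoint on S -
  {1}, and S would have odd order.\<close>

lemma uminus_one_in_nonzero_squares:
  assumes "CARD('a::{field, finite}) mod 4 = 1"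
  shows "(-1 :: 'a) \<in> nonzero_squares"
proof (rule ccontr)
  assume neg: "(-1 :: 'a) \<notin> nonzero_squares"
  have "odd (CARD('a))" using assms by presburger
  from card_nonzero_squares[OF this] assms have "even (card (nonzero_squares :: 'a set))"
    by presburger
  moreover have "even (card (nonzero_squares - {1 :: 'a}))"
  proof (rule even_card_if_fixpoint_free_involution[where i = inverse])
    fix x :: 'a assume x: "x \<in> nonzero_squares - {1}"
    then show "inverse x \<in> nonzero_squares - {1}"
      by (auto intro: nonzero_squares_inverse)
    show "inverse x \<noteq> x"
    proof
      assume "inverse x = x"
      moreover have "x \<noteq> 0" using x by auto
      ultimately have "x * x = 1" by (metis right_inverse)
      then have "x = 1 \<or> x = - 1" by (simp add: square_eq_1_iff)
      with x neg show False by auto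
    qed
  qed auto
  moreover have "card (nonzero_squares :: 'a set) \<noteq> 0"
    using one_in_nonzero_squares by (metis card_eq_0_iff empty_iff finite)
  ultimately show False by (simp add: card_Diff_singleton)
qed

section \<open>Symmetric 2 by 2 matrices in terms of their entries\<close>

lemma det_2D:
  assumes A: "A \<in> carrier_mat 2 2"
  shows "det A = A $$ (0, 0) * A $$ (1, 1) - A $$ (0, 1) * A $$ (1, 0)"
proof -
  have "{..<2} = {0, 1 :: nat}" by auto
  with A show ?thesis
    by (simp add: laplace_expansion_row[OF A, of 0] cofactor_def mat_delete_def det_single)
qed

text \<open>The matrix meant is (a, b; b, c). Preservation stated for entries passes by induction to
  the iterates of \<open>f\<close>.\<close>

definition pd_entries :: "'a::field \<Rightarrow> 'a \<Rightarrow> 'a \<Rightarrow> bool" where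
  "pd_entries a b c \<longleftrightarrow> a \<in> nonzero_squares \<and> a * c - b\<^sup>2 \<in> nonzero_squares"

definition sym_mat :: "'a \<Rightarrow> 'a \<Rightarrow> 'a \<Rightarrow> 'a mat" where
  "sym_mat a b c = mat 2 2 (\<lambda>(i, j). if i \<noteq> j then b else if i = 0 then a else c)"

lemma positive_definite_sym_mat:
  "positive_definite 2 (sym_mat a b c) \<longleftrightarrow> pd_entries a b c"
proof -
  have "{1..2} = {1, 2 :: nat}" by auto
  moreover have "sym_mat a b c \<in> carrier_mat 2 2" "transpose_mat (sym_mat a b c) = sym_mat a b c"
    by (auto simp: sym_mat_def)
  moreover have "leading_principal_minor (sym_mat a b c) 1 = a"
    by (simp add: leading_principal_minor_def sym_mat_def det_single)
  moreover have "leading_principal_minor (sym_mat a b c) 2 = a * c - b\<^sup>2"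
    by (simp add: leading_principal_minor_def sym_mat_def det_2D[of "mat 2 2 _"] power2_eq_square)
  ultimately show ?thesis by (simp add: positive_definite_def pd_entries_def)
qed

lemma preserves_positive_definiteness_2D:
  assumes "preserves_positive_definiteness 2 f" and "pd_entries a b c"
  shows "pd_entries (f a) (f b) (f c)"
proof -
  have "map_mat f (sym_mat a b c) = sym_mat (f a) (f b) (f c)"
    by (auto simp: sym_mat_def)
  moreover have "sym_mat a b c \<in> carrier_mat 2 2" by (simp add: sym_mat_def)
  ultimately show ?thesis
    using assms by (metis preserves_positive_definiteness_def positive_definite_sym_mat)
qed

section \<open>Test matrices for a preserver\<close>

context
  fixes f :: "'a::{field, finite} \<Rightarrow> 'a"
  assumes card: "CARD('a) mod 4 = 1"
    and pres: "\<And>a b c. pd_entries a b c \<Longrightarrow> pd_entries (f a) (f b) (f c)"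
begin

lemma odd_card: "odd (CARD('a))"
  using card by presburger

lemma diff_commute_nonzero_squares:
  "(x :: 'a) - y \<in> nonzero_squares \<longleftrightarrow> y - x \<in> nonzero_squares"
  using nonzero_squares_mult_iff[OF uminus_one_in_nonzero_squares[OF card], of "y - x"] by simp

lemma preserver_nonzero_squares: "a \<in> nonzero_squares \<Longrightarrow> f a \<in> nonzero_squares"
  \<comment> \<open>Both leading minors of the diagonal matrix (a, 0; 0, 1) are
    \<open>a\<close>.\<close>
  using pres[of a 0 1] by (simp add: pd_entries_def)

text \<open>The matrix (a, a; a, c) has determinant \<open>a * (c - a)\<close>; the order of a
  difference is irrelevant because -1 is in S.\<close>

lemma preserver_diff_square:
  assumes "a \<in> nonzero_squares" "a - c \<in> nonzero_squares"
  shows "f a - f c \<in> nonzero_squares"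
proof -
  have "pd_entries a a c"
    using assms nonzero_squares_mult[of a "c - a"] diff_commute_nonzero_squares[of a c]
    by (simp add: pd_entries_def power2_eq_square right_diff_distrib)
  then have "f a * (f c - f a) \<in> nonzero_squares"
    using pres by (fastforce simp: pd_entries_def power2_eq_square right_diff_distrib)
  then show ?thesis
    using nonzero_squares_mult_iff[OF preserver_nonzero_squares[OF assms(1)]]
      diff_commute_nonzero_squares by blast
qed

text \<open>The matrix (a, c; c, c) has determinant \<open>c * (a - c)\<close>, here a product of
  two nonsquares.\<close>

lemma preserver_diff_nonsquare:
  assumes "a \<in> nonzero_squares" "c \<in> nonsquares" "a - c \<notin> nonzero_squares"
  shows "f c * (f a - f c) \<in> nonzero_squares"
proof -
  have "a - c \<in> nonsquares" using assms by (auto simp: nonsquares_def)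
  then have "c * (a - c) \<in> nonzero_squares"
    using nonsquares_mult[OF odd_card assms(2)] by blast
  then have "pd_entries a c c"
    using assms(1) by (simp add: pd_entries_def algebra_simps power2_eq_square)
  from pres[OF this] show ?thesis
    by (simp add: pd_entries_def algebra_simps power2_eq_square)
qed

lemma preserver_neq_if_square:
  assumes "a \<in> nonzero_squares" "c \<in> nonsquares"
  shows "f a \<noteq> f c"
proof
  assume "f a = f c"
  then show False
    using preserver_diff_square[OF assms(1), of c] preserver_diff_nonsquare[OF assms]
    by (cases "a - c \<in> nonzero_squares") simp_all
qed

lemma preserver_nonsquare_neq_0:
  assumes c: "c \<in> nonsquares"
  shows "f c \<noteq> 0"
proof
  assume "f c = 0"
  then have diff: "a - c \<in> nonzero_squares" if "a \<in> nonzero_squares" for a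
    using preserver_diff_nonsquare[OF that c] by auto
  have c0: "c \<noteq> 0" using c by (auto simp: nonsquares_def)
  \<comment> \<open>The quotient is 1 - c / a, which differs from 1 and determines \<open>a\<close>;
    so S would inject into S - {1}.\<close>
  have "inverse a * (a - c) \<in> nonzero_squares - {1}" if "a \<in> nonzero_squares" for a
  proof -
    have "a \<noteq> 0" using that by auto
    with c0 have "inverse a * (a - c) \<noteq> 1" by (auto simp: field_simps)
    with that diff show ?thesis by (simp add: nonzero_squares_mult nonzero_squares_inverse)
  qed
  moreover have "inj_on (\<lambda>a. inverse a * (a - c)) nonzero_squares"
  proof (rule inj_onI)
    fix a b assume *: "a \<in> nonzero_squares" "b \<in> nonzero_squares"
      "inverse a * (a - c) = inverse b * (b - c)"
    then have "a \<noteq> 0" "b \<noteq> 0" by auto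
    with *(3) c0 show "a = b" by (simp add: field_simps)
  qed
  ultimately have "card (nonzero_squares :: 'a set) \<le> card (nonzero_squares - {1 :: 'a})"
    by (intro card_inj_on_le) auto
  moreover have "card (nonzero_squares - {1 :: 'a}) < card (nonzero_squares :: 'a set)"
    by (intro card_Diff1_less) auto
  ultimately show False by simp
qed

end

text \<open>If the orbit of \<open>c\<close> repeats at times k < l, then \<open>f ^^ k\<close>
  agrees on the nonsquare \<open>c\<close> and on \<open>(f ^^ (l - k)) c\<close>, which lies in S.
  As \<open>f ^^ k\<close> is again a preserver, this is impossible.\<close>

lemma preserver_nonsquare_notin_nonzero_squares:
  fixes f :: "'a::{field, finite} \<Rightarrow> 'a"
  assumes card: "CARD('a) mod 4 = 1"
    and pres: "\<And>a b c. pd_entries a b c \<Longrightarrow> pd_entries (f a) (f b) (f c)"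
    and c: "c \<in> nonsquares"
  shows "f c \<notin> nonzero_squares"
proof
  assume fc: "f c \<in> nonzero_squares"
  have pres_iter: "pd_entries a b d \<Longrightarrow> pd_entries ((f ^^ m) a) ((f ^^ m) b) ((f ^^ m) d)" for m a b d
    by (induction m) (auto intro: pres)
  have orbit: "(f ^^ Suc m) c \<in> nonzero_squares" for m
    using preserver_nonzero_squares[OF card pres_iter fc] by (simp add: funpow_swap1)
  have "\<not> inj (\<lambda>m. (f ^^ m) c)"
    using finite_imageD[of "\<lambda>m. (f ^^ m) c" "UNIV :: nat set"] by auto
  then obtain k l where "k < l" "(f ^^ k) c = (f ^^ l) c"
    unfolding inj_def by (metis linorder_neqE_nat)
  \<comment> \<open>The exponent is l - k, written as a successor to match
    \<open>orbit\<close>.\<close>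
  then have "(f ^^ k) c = (f ^^ k) ((f ^^ Suc (l - k - 1)) c)"
    using funpow_add[of k "Suc (l - k - 1)" f] by (simp del: funpow.simps)
  then show False
    using preserver_neq_if_square[where f = "f ^^ k", OF card pres_iter orbit c] by metis
qed

theorem theorem1p1:
  fixes f :: "'a::{field, finite} \<Rightarrow> 'a" and q :: nat
  assumes "q = CARD('a)"
    and "q mod 4 = 1"
    and "preserves_positive_definiteness 2 f"
  shows "inj_on f nonzero_squares"
proof (rule inj_onI, rule ccontr)
  fix a b :: 'a
  assume a: "a \<in> nonzero_squares" and b: "b \<in> nonzero_squares" and eq: "f a = f b" and "a \<noteq> b"
  have card: "CARD('a) mod 4 = 1" using assms by simp
  note pres = preserves_positive_definiteness_2D[OF assms(3)]
  note odd = odd_card[OF card]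
  have ns: "f c \<in> nonsquares" if "c \<in> nonsquares" for c
    using preserver_nonsquare_notin_nonzero_squares[where f = f, OF card pres that]
      preserver_nonsquare_neq_0[where f = f, OF card pres that] by (simp add: nonsquares_def)
  \<comment> \<open>For the converse: if \<open>x - c\<close> is not in S, then
    \<open>f c * (f x - f c)\<close> is, and since \<open>f c\<close> is a nonsquare,
    \<open>f x - f c\<close> cannot be in S.\<close>
  have iff: "x - c \<in> nonzero_squares \<longleftrightarrow> f x - f c \<in> nonzero_squares"
    if "x \<in> nonzero_squares" "c \<in> nonsquares" for x c
    using preserver_diff_square[where f = f, OF card pres that(1)] preserver_diff_nonsquare[where f = f, OF card pres that]
      ns[OF that(2)] nonzero_squares_mult_iff[of "f x - f c" "f c"]
    by (auto simp: nonsquares_def mult.commute)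
  have "(a - c) * inverse (b - c) \<in> nonzero_squares - {1}" if c: "c \<in> nonsquares" for c
  proof -
    have ne: "a - c \<noteq> 0" "b - c \<noteq> 0" using a b c by (auto simp: nonsquares_def)
    have same: "a - c \<in> nonzero_squares \<longleftrightarrow> b - c \<in> nonzero_squares"
      using iff[OF a c] iff[OF b c] eq by simp
    \<comment> \<open>Both factors are squares or both are nonsquares; division by the square of
      \<open>b - c\<close> then gives the quotient.\<close>
    have "(a - c) * (b - c) \<in> nonzero_squares"
      using same ne nonzero_squares_mult nonsquares_mult[OF odd]
      by (cases "a - c \<in> nonzero_squares") (auto simp: nonsquares_def)
    moreover have "inverse (b - c) * inverse (b - c) \<in> nonzero_squares"
      using ne by (auto simp: nonzero_squares_def power2_eq_square intro!: exI[of _ "inverse (b - c)"])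
    ultimately have "(a - c) * (b - c) * (inverse (b - c) * inverse (b - c)) \<in> nonzero_squares"
      by (rule nonzero_squares_mult)
    moreover have "(a - c) * (b - c) * (inverse (b - c) * inverse (b - c)) = (a - c) * inverse (b - c)"
      using ne by simp
    moreover have "(a - c) * inverse (b - c) \<noteq> 1"
      using ne \<open>a \<noteq> b\<close> by (simp add: field_simps)
    ultimately show ?thesis by simp
  qed
  moreover have "inj_on (\<lambda>c. (a - c) * inverse (b - c)) nonsquares"
  proof (rule inj_onI)
    fix c d assume *: "c \<in> nonsquares" "d \<in> nonsquares"
      "(a - c) * inverse (b - c) = (a - d) * inverse (b - d)"
    then have "b - c \<noteq> 0" "b - d \<noteq> 0" using b by (auto simp: nonsquares_def)
    with *(3) have "(a - c) * (b - d) = (a - d) * (b - c)" by (simp add: field_simps)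
    \<comment> \<open>This product is the difference of the two sides of the cross-multiplied
      equation.\<close>
    then have "(a - b) * (c - d) = 0" by (simp add: algebra_simps)
    with \<open>a \<noteq> b\<close> show "c = d" by simp
  qed
  ultimately have "card (nonsquares :: 'a set) \<le> card (nonzero_squares - {1 :: 'a})"
    by (intro card_inj_on_le) auto
  moreover have "card (nonzero_squares - {1 :: 'a}) < card (nonzero_squares :: 'a set)"
    by (intro card_Diff1_less) auto
  ultimately show False using card_nonsquares[OF odd] by simp
qed

end
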